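(* Let $G=N\rtimes H$ be a semidirect product of finitely generated groups $N$ and $H$ (with $N$ normal). If $F$ is a finite group and $N$ surjects to $F$, then there exists a finite index subgroup $L$ of $G$ such that $N\le L$ and $L$ surjects to $F$.
   Context: A group surjects to $F$ if there is a surjective homomorphism from it onto $F$. *)

theory Defs
  imports "HOL-Algebra.Algebra"
begin

definition finitely_generated_group :: "('a, 'b) monoid_scheme \<Rightarrow> bool" where
  "finitely_generated_group G \<longleftrightarrow>
     group G \<and> (\<exists>S. finite S \<and> S \<subseteq> carrier G \<and> generate G S = carrier G)"

text \<open>The internal semidirect product: \<open>G\<close> splits as \<open>N \<rtimes> H\<close>, with \<open>H\<close> acting on the
  normal subgroup \<open>N\<close> by conjugation.\<close>

definition is_semidirect_product :: "('a, 'b) monoid_scheme \<Rightarrow> 'a set \<Rightarrow> 'a set \<Rightarrow> bool" where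
  "is_semidirect_product G N H \<longleftrightarrow>
     group G \<and> N \<lhd> G \<and> subgroup H G \<and> N \<inter> H = {\<one>\<^bsub>G\<^esub>} \<and> N <#>\<^bsub>G\<^esub> H = carrier G"

definition finite_index_subgroup :: "'a set \<Rightarrow> ('a, 'b) monoid_scheme \<Rightarrow> bool" where
  "finite_index_subgroup L G \<longleftrightarrow> subgroup L G \<and> finite (rcosets\<^bsub>G\<^esub> L)"

definition surjects_to :: "('a, 'b) monoid_scheme \<Rightarrow> ('c, 'd) monoid_scheme \<Rightarrow> bool" where
  "surjects_to G F \<longleftrightarrow> (\<exists>f. f \<in> epi G F)"

end

theory Submission
  imports Defs
begin

text \<open>Let \<open>f\<close> map \<open>N\<close> onto \<open>F\<close>. Since \<open>N\<close> is finitely generated and \<open>F\<close> is finite, there are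
  only finitely many homomorphisms from \<open>N\<close> to \<open>F\<close>, so the stabiliser \<open>K\<close> of \<open>f\<close> under the
  conjugation action of \<open>H\<close> has finite index in \<open>H\<close>, and \<open>L = N K\<close> has finite index in \<open>G\<close>.
  Because \<open>f\<close> is \<open>K\<close>-invariant, \<open>n k \<mapsto> f n\<close> is a homomorphism on \<open>L\<close>.\<close>

section \<open>Generators and finite images\<close>

text \<open>Lets finite generation of \<open>N\<close> do its work: a homomorphism out of
  \<open>N\<close> is controlled by finitely many values.\<close>

lemma hom_eq_on_generators:
  assumes "group A" "group B" "f \<in> hom A B" "g \<in> hom A B"
    and "S \<subseteq> carrier A" "\<And>s. s \<in> S \<Longrightarrow> f s = g s" "x \<in> generate A S"
  shows "f x = g x"
proof -
  interpret f: group_hom A B f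
    using assms by (simp add: group_hom_def group_hom_axioms_def)
  interpret g: group_hom A B g
    using assms by (simp add: group_hom_def group_hom_axioms_def)
  from \<open>x \<in> generate A S\<close> show ?thesis
  proof (induction rule: generate.induct)
    case (inv h)
    then have "h \<in> carrier A" using assms(5) by blast
    then show ?case using inv assms(6) by simp
  next
    case (eng h1 h2)
    then show ?case
      using group.generate_in_carrier[OF assms(1,5)] by simp
  qed (use assms(6) in auto)
qed

text \<open>On \<open>A\<close>, the map \<open>q\<close> factors through \<open>p\<close>, so
  \<open>q\<close> A\<open>is an image of\<close>p \<open>A\<close>. In the application
  \<open>q\<close> sends \<open>h\<close> to its coset and \<open>p\<close> sends \<open>h\<close>
  to a finite tuple of values.\<close>

lemma finite_image_factor:
  assumes "finite (p ` A)" "\<And>x y. \<lbrakk>x \<in> A; y \<in> A; p x = p y\<rbrakk> \<Longrightarrow> q x = q y"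
  shows "finite (q ` A)"
proof (rule finite_surj[OF assms(1)])
  show "q ` A \<subseteq> (\<lambda>z. q (inv_into A p z)) ` p ` A"
  proof
    fix y assume "y \<in> q ` A"
    then obtain x where x: "x \<in> A" "y = q x" by blast
    have "q x = q (inv_into A p (p x))"
      by (rule assms(2)) (use x in \<open>auto simp: inv_into_into f_inv_into_f\<close>)
    with x show "y \<in> (\<lambda>z. q (inv_into A p z)) ` p ` A" by blast
  qed
qed

section \<open>The conjugation action and the stabiliser\<close>

text \<open>Precomposition with conjugation by \<open>h\<close> is a right action of
  \<open>H\<close> on maps out of \<open>N\<close>; this is the stabiliser of \<open>f\<close>.
  Being a right action, it pairs with right cosets and with elements of the form
  \<open>h \<otimes> inv k\<close>.\<close>

definition hom_stabilizer ::
    "('a, 'b) monoid_scheme \<Rightarrow> 'a set \<Rightarrow> 'a set \<Rightarrow> ('a \<Rightarrow> 'c) \<Rightarrow> 'a set" where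
  "hom_stabilizer G N H f =
     {h \<in> H. \<forall>n\<in>N. f (h \<otimes>\<^bsub>G\<^esub> n \<otimes>\<^bsub>G\<^esub> inv\<^bsub>G\<^esub> h) = f n}"

context group
begin

lemma inv_mult_cancel_left:
  assumes "x \<in> carrier G" "y \<in> carrier G"
  shows "inv x \<otimes> (x \<otimes> y) = y"
  using assms by (simp flip: m_assoc)

lemma subset_set_mult:
  assumes "A \<subseteq> carrier G" "B \<subseteq> carrier G"
  shows "\<one> \<in> B \<Longrightarrow> A \<subseteq> A <#> B" "\<one> \<in> A \<Longrightarrow> B \<subseteq> A <#> B"
proof -
  show "A \<subseteq> A <#> B" if "\<one> \<in> B"
  proof
    fix a assume "a \<in> A"
    then have "a = a \<otimes> \<one>" using assms by auto
    with \<open>a \<in> A\<close> that show "a \<in> A <#> B" unfolding set_mult_def by blast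
  qed
  show "B \<subseteq> A <#> B" if "\<one> \<in> A"
  proof
    fix b assume "b \<in> B"
    then have "b = \<one> \<otimes> b" using assms by auto
    with \<open>b \<in> B\<close> that show "b \<in> A <#> B" unfolding set_mult_def by blast
  qed
qed

text \<open>Conjugation by \<open>h\<close> is an endomorphism of the normal subgroup
  \<open>N\<close>, so the translates of \<open>f\<close> are again homomorphisms and can be
  compared on generators.\<close>

lemma conj_hom:
  assumes "N \<lhd> G" "h \<in> carrier G" "f \<in> hom (G\<lparr>carrier := N\<rparr>) F"
  shows "(\<lambda>n. f (h \<otimes> n \<otimes> inv h)) \<in> hom (G\<lparr>carrier := N\<rparr>) F"
proof (rule homI)
  interpret N: normal N G by fact
  note c [simp] = N.mem_carrier N.inv_op_closed2[OF assms(2)] assms(2)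
  show "f (h \<otimes> x \<otimes> inv h) \<in> carrier F" if "x \<in> carrier (G\<lparr>carrier := N\<rparr>)" for x
    using that assms(3) by (auto simp: hom_def)
  fix x y assume "x \<in> carrier (G\<lparr>carrier := N\<rparr>)" "y \<in> carrier (G\<lparr>carrier := N\<rparr>)"
  then have xy: "x \<in> N" "y \<in> N" by auto
  have "h \<otimes> (x \<otimes> y) \<otimes> inv h = (h \<otimes> x \<otimes> inv h) \<otimes> (h \<otimes> y \<otimes> inv h)"
    using xy by (simp add: m_assoc inv_mult_cancel_left)
  then show "f (h \<otimes> (x \<otimes>\<^bsub>G\<lparr>carrier := N\<rparr>\<^esub> y) \<otimes> inv h) =
      f (h \<otimes> x \<otimes> inv h) \<otimes>\<^bsub>F\<^esub> f (h \<otimes> y \<otimes> inv h)"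
    using xy hom_mult[OF assms(3), of "h \<otimes> x \<otimes> inv h" "h \<otimes> y \<otimes> inv h"] by simp
qed

lemma conj_conj:
  assumes "h \<in> carrier G" "k \<in> carrier G" "n \<in> carrier G"
  shows "(h \<otimes> k) \<otimes> n \<otimes> inv (h \<otimes> k) = h \<otimes> (k \<otimes> n \<otimes> inv k) \<otimes> inv h"
  using assms by (simp add: m_assoc inv_mult_group)

lemma subgroup_hom_stabilizer:
  assumes "N \<lhd> G" "subgroup H G"
  shows "subgroup (hom_stabilizer G N H f) G"
proof -
  interpret N: normal N G by fact
  interpret H: subgroup H G by fact
  show ?thesis
  proof (rule subgroupI)
    show "hom_stabilizer G N H f \<subseteq> carrier G"
      by (auto simp: hom_stabilizer_def)
    have "\<one> \<in> hom_stabilizer G N H f"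
      by (simp add: hom_stabilizer_def)
    then show "hom_stabilizer G N H f \<noteq> {}" by blast
  next
    fix a assume a: "a \<in> hom_stabilizer G N H f"
    then have aH: "a \<in> H" and ac: "a \<in> carrier G" by (auto simp: hom_stabilizer_def)
    have "f (inv a \<otimes> n \<otimes> inv (inv a)) = f n" if "n \<in> N" for n
    proof -
      have m: "inv a \<otimes> n \<otimes> inv (inv a) \<in> N"
        using that ac N.inv_op_closed2 by blast
      \<comment> \<open>Invariance under \<open>a\<close> is used at the conjugate of
        \<open>n\<close> by \<open>inv a\<close>, which \<open>a\<close> carries back to
        \<open>n\<close>.\<close>
      have "a \<otimes> (inv a \<otimes> n \<otimes> inv (inv a)) \<otimes> inv a = n"
        using conj_conj[of a "inv a" n] ac that N.mem_carrier by simp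
      with a m show ?thesis by (auto simp: hom_stabilizer_def)
    qed
    then show "inv a \<in> hom_stabilizer G N H f"
      using aH by (simp add: hom_stabilizer_def)
  next
    fix a b assume ab: "a \<in> hom_stabilizer G N H f" "b \<in> hom_stabilizer G N H f"
    then have c: "a \<in> H" "b \<in> H" "a \<in> carrier G" "b \<in> carrier G"
      by (auto simp: hom_stabilizer_def)
    have "f (a \<otimes> b \<otimes> n \<otimes> inv (a \<otimes> b)) = f n" if "n \<in> N" for n
      using that c ab N.inv_op_closed2[of b n] N.mem_carrier[of n]
      by (simp add: conj_conj) (simp add: hom_stabilizer_def)
    then show "a \<otimes> b \<in> hom_stabilizer G N H f"
      using c by (simp add: hom_stabilizer_def)
  qed
qed

text \<open>The orbit-stabiliser argument: if \<open>h\<close> and \<open>k\<close> move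
  \<open>f\<close> to the same map on \<open>N\<close>, evaluating both at the conjugate of
  \<open>n\<close> by \<open>inv k\<close> shows that \<open>h \<otimes> inv k\<close> fixes
  \<open>f\<close>.\<close>

lemma conj_eq_imp_hom_stabilizer:
  assumes "N \<lhd> G" "subgroup H G" "h \<in> H" "k \<in> H"
    and eq: "\<And>n. n \<in> N \<Longrightarrow> f (h \<otimes> n \<otimes> inv h) = f (k \<otimes> n \<otimes> inv k)"
  shows "h \<otimes> inv k \<in> hom_stabilizer G N H f"
proof -
  interpret N: normal N G by fact
  interpret H: subgroup H G by fact
  have c: "h \<in> carrier G" "k \<in> carrier G" using assms by auto
  have "f (h \<otimes> inv k \<otimes> n \<otimes> inv (h \<otimes> inv k)) = f n" if n: "n \<in> N" for n
  proof -
    have m: "inv k \<otimes> n \<otimes> inv (inv k) \<in> N"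
      using n c N.inv_op_closed2 by blast
    have nc: "n \<in> carrier G" using n by simp
    have "f (h \<otimes> inv k \<otimes> n \<otimes> inv (h \<otimes> inv k)) =
        f (h \<otimes> (inv k \<otimes> n \<otimes> inv (inv k)) \<otimes> inv h)"
      using conj_conj[of h "inv k" n] c nc by simp
    also have "\<dots> = f (k \<otimes> (inv k \<otimes> n \<otimes> inv (inv k)) \<otimes> inv k)"
      using eq m by blast
    also have "\<dots> = f n"
      using conj_conj[of k "inv k" n] c nc by simp
    finally show ?thesis .
  qed
  then show ?thesis using assms by (simp add: hom_stabilizer_def)
qed

section \<open>Finite index and extension of the homomorphism\<close>

text \<open>The cosets of \<open>L\<close> are counted directly: each has a representative
  \<open>h\<close> in \<open>H\<close>, and \<open>L #> h\<close> depends only on the values on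
  \<open>S\<close> of \<open>f\<close> translated by \<open>h\<close>.\<close>

lemma finite_index_mult_hom_stabilizer:
  assumes sd: "is_semidirect_product G N H"
    and fg: "finitely_generated_group (G\<lparr>carrier := N\<rparr>)"
    and F: "group F" "finite (carrier F)"
    and f: "f \<in> hom (G\<lparr>carrier := N\<rparr>) F"
  shows "finite_index_subgroup (N <#> hom_stabilizer G N H f) G"
proof -
  define K where "K = hom_stabilizer G N H f"
  define L where "L = N <#> K"
  have NG: "N \<lhd> G" and HG: "subgroup H G" and NH: "N <#> H = carrier G"
    using sd by (auto simp: is_semidirect_product_def)
  interpret N: normal N G by fact
  interpret H: subgroup H G by fact
  have KG: "subgroup K G"
    unfolding K_def using NG HG by (rule subgroup_hom_stabilizer)
  interpret K: subgroup K G by fact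
  have LG: "subgroup L G"
    unfolding L_def using NG KG by (rule mult_norm_subgroup)
  have NL: "N \<subseteq> L"
    unfolding L_def using subset_set_mult(1)[OF N.subset K.subset] by simp
  have KL: "K \<subseteq> L"
    unfolding L_def using subset_set_mult(2)[OF N.subset K.subset] by simp
  obtain S where S: "finite S" "S \<subseteq> N" "generate (G\<lparr>carrier := N\<rparr>) S = N"
    using fg by (auto simp: finitely_generated_group_def)
  have A: "group (G\<lparr>carrier := N\<rparr>)"
    using fg by (simp add: finitely_generated_group_def)
  \<comment> \<open>Restricting to \<open>S\<close> places \<open>p h\<close> in the extensional
    function space from \<open>S\<close> to \<open>carrier F\<close>, which is finite.\<close>
  define p where "p h = restrict (\<lambda>n. f (h \<otimes> n \<otimes> inv h)) S" for h
  have "p ` H \<subseteq> S \<rightarrow>\<^sub>E carrier F"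
  proof -
    have "f (h \<otimes> s \<otimes> inv h) \<in> carrier F" if "h \<in> H" "s \<in> S" for h s
      using hom_in_carrier[OF conj_hom[OF NG _ f], of h s] that S(2) by auto
    then show ?thesis unfolding p_def by auto
  qed
  then have fin: "finite (p ` H)"
    by (rule finite_subset) (use S(1) F(2) in \<open>simp add: finite_PiE\<close>)
  \<comment> \<open>Agreement on the generators gives agreement on \<open>N\<close>, hence
    \<open>h \<otimes> inv k\<close> lies in the stabiliser and so in \<open>L\<close>.\<close>
  have coset_eq: "L #> h = L #> k" if hk: "h \<in> H" "k \<in> H" and p: "p h = p k" for h k
  proof -
    have c: "h \<in> carrier G" "k \<in> carrier G" using hk by auto
    have "f (h \<otimes> n \<otimes> inv h) = f (k \<otimes> n \<otimes> inv k)" if "n \<in> N" for n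
    proof (rule hom_eq_on_generators[OF A F(1) conj_hom[OF NG c(1) f] conj_hom[OF NG c(2) f]])
      show "S \<subseteq> carrier (G\<lparr>carrier := N\<rparr>)" using S by simp
      show "f (h \<otimes> s \<otimes> inv h) = f (k \<otimes> s \<otimes> inv k)" if "s \<in> S" for s
        using fun_cong[OF p, of s] that by (simp add: p_def)
      show "n \<in> generate (G\<lparr>carrier := N\<rparr>) S" using S \<open>n \<in> N\<close> by simp
    qed
    then have "h \<otimes> inv k \<in> L"
      using conj_eq_imp_hom_stabilizer[OF NG HG hk] KL unfolding K_def by blast
    then have "h \<in> L #> k"
      using c by (auto simp: r_coset_def m_assoc intro!: bexI[of _ "h \<otimes> inv k"])
    then show ?thesis using repr_independence[OF _ c(2) LG] by simp
  qed
  \<comment> \<open>Writing \<open>g = n \<otimes> h\<close>, the factor \<open>n\<close> is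
    absorbed because \<open>N\<close> lies in \<open>L\<close>.\<close>
  have "rcosets L \<subseteq> (\<lambda>h. L #> h) ` H"
  proof
    fix C assume "C \<in> rcosets L"
    then obtain g where g: "g \<in> carrier G" "C = L #> g"
      by (auto simp: RCOSETS_def)
    then obtain n h where nh: "n \<in> N" "h \<in> H" "g = n \<otimes> h"
      unfolding NH[symmetric] by (auto simp: set_mult_def)
    have "g \<in> L #> h" using nh NL by (auto simp: r_coset_def)
    then have "L #> h = L #> g"
      using repr_independence[OF _ _ LG] nh by simp
    then show "C \<in> (\<lambda>h. L #> h) ` H" using g nh by blast
  qed
  then have "finite (rcosets L)"
    by (rule finite_subset) (rule finite_image_factor[OF fin coset_eq])
  then show ?thesis
    using LG by (simp add: finite_index_subgroup_def L_def K_def)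
qed

text \<open>Trivial intersection of \<open>N\<close> and \<open>H\<close> makes the
  \<open>N\<close>-component well defined; invariance of \<open>f\<close> under the stabiliser makes
  its composite with \<open>f\<close> multiplicative.\<close>

lemma hom_extends_to_mult_hom_stabilizer:
  assumes sd: "is_semidirect_product G N H"
    and f: "f \<in> hom (G\<lparr>carrier := N\<rparr>) F"
  obtains g where "g \<in> hom (G\<lparr>carrier := N <#> hom_stabilizer G N H f\<rparr>) F"
    and "\<And>n. n \<in> N \<Longrightarrow> g n = f n"
proof -
  define K where "K = hom_stabilizer G N H f"
  have NG: "N \<lhd> G" and HG: "subgroup H G" and int: "N \<inter> H = {\<one>}"
    using sd by (auto simp: is_semidirect_product_def)
  interpret N: normal N G by fact
  interpret H: subgroup H G by fact
  have KG: "subgroup K G"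
    unfolding K_def using NG HG by (rule subgroup_hom_stabilizer)
  interpret K: subgroup K G by fact
  have KH: "K \<subseteq> H" by (auto simp: K_def hom_stabilizer_def)
  have unique: "n = n'"
    if "n \<in> N" "n' \<in> N" "k \<in> K" "k' \<in> K" "n \<otimes> k = n' \<otimes> k'" for n n' k k'
  proof -
    have c: "n \<in> carrier G" "n' \<in> carrier G" "k \<in> carrier G" "k' \<in> carrier G"
      using that by auto
    \<comment> \<open>Separating the factors puts one element in both \<open>N\<close> and
      \<open>H\<close>.\<close>
    have "inv n' \<otimes> n = k' \<otimes> inv k"
      using that(5) c by (metis inv_closed inv_solve_left inv_solve_right m_assoc m_closed)
    moreover have "inv n' \<otimes> n \<in> N" "k' \<otimes> inv k \<in> H"
      using that KH by auto
    ultimately have "inv n' \<otimes> n = \<one>" using int by auto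
    then show ?thesis using c by (metis inv_equality inv_inv inv_closed)
  qed
  \<comment> \<open>The description selects the \<open>N\<close>-component, which
    \<open>unique\<close> justifies on \<open>N <#> K\<close>; elsewhere the value is
    unspecified.\<close>
  define g where "g x = f (THE n. n \<in> N \<and> (\<exists>k\<in>K. x = n \<otimes> k))" for x
  have g: "g (n \<otimes> k) = f n" if "n \<in> N" "k \<in> K" for n k
  proof -
    have "(THE n'. n' \<in> N \<and> (\<exists>k'\<in>K. n \<otimes> k = n' \<otimes> k')) = n"
      by (rule the_equality) (use that unique in blast)+
    then show ?thesis by (simp add: g_def)
  qed
  show thesis
  proof
    show "g n = f n" if "n \<in> N" for n
      using g[OF that K.one_closed] that by simp
    show "g \<in> hom (G\<lparr>carrier := N <#> hom_stabilizer G N H f\<rparr>) F"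
      unfolding K_def[symmetric]
    proof (rule homI)
      show "g x \<in> carrier F" if "x \<in> carrier (G\<lparr>carrier := N <#> K\<rparr>)" for x
        using that g hom_in_carrier[OF f] by (auto simp: set_mult_def)
      fix x y assume "x \<in> carrier (G\<lparr>carrier := N <#> K\<rparr>)" "y \<in> carrier (G\<lparr>carrier := N <#> K\<rparr>)"
      then obtain n k m l where e: "n \<in> N" "k \<in> K" "x = n \<otimes> k" "m \<in> N" "l \<in> K" "y = m \<otimes> l"
        by (auto simp: set_mult_def)
      have c: "n \<in> carrier G" "k \<in> carrier G" "m \<in> carrier G" "l \<in> carrier G"
        using e by auto
      have km: "k \<otimes> m \<otimes> inv k \<in> N" using e c N.inv_op_closed2 by blast
      \<comment> \<open>Moving \<open>k\<close> to the right past \<open>m\<close> conjugates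
        \<open>m\<close>, which displays the \<open>N\<close>-component of the product.\<close>
      have "x \<otimes> y = (n \<otimes> (k \<otimes> m \<otimes> inv k)) \<otimes> (k \<otimes> l)"
        using e(3,6) c by (simp add: m_assoc inv_mult_cancel_left)
      then have "g (x \<otimes> y) = f (n \<otimes> (k \<otimes> m \<otimes> inv k))"
        using g e km by simp
      also have "\<dots> = f n \<otimes>\<^bsub>F\<^esub> f (k \<otimes> m \<otimes> inv k)"
        using hom_mult[OF f, of n] e km by simp
      \<comment> \<open>The stabiliser condition on \<open>k\<close> removes the
        conjugation.\<close>
      also have "f (k \<otimes> m \<otimes> inv k) = f m"
        using e by (simp add: K_def hom_stabilizer_def)
      finally show "g (x \<otimes>\<^bsub>G\<lparr>carrier := N <#> K\<rparr>\<^esub> y) = g x \<otimes>\<^bsub>F\<^esub> g y"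
        using g e by simp
    qed
  qed
qed

end

theorem proposition4p1:
  fixes G :: "('a, 'b) monoid_scheme" and N H :: "'a set"
    and F :: "('c, 'd) monoid_scheme"
  assumes "is_semidirect_product G N H"
    and "finitely_generated_group (G\<lparr>carrier := N\<rparr>)"
    and "finitely_generated_group (G\<lparr>carrier := H\<rparr>)"
    and "group F" and "finite (carrier F)"
    and "surjects_to (G\<lparr>carrier := N\<rparr>) F"
  shows "\<exists>L. finite_index_subgroup L G \<and> N \<subseteq> L \<and> surjects_to (G\<lparr>carrier := L\<rparr>) F"
proof -
  interpret group G using assms(1) by (simp add: is_semidirect_product_def)
  have NG: "N \<lhd> G" and HG: "subgroup H G"
    using assms(1) by (auto simp: is_semidirect_product_def)
  interpret N: normal N G by fact
  obtain f where f: "f \<in> hom (G\<lparr>carrier := N\<rparr>) F" and sur: "f ` N = carrier F"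
    using assms(6) by (auto simp: surjects_to_def epi_def)
  define L where "L = N <#>\<^bsub>G\<^esub> hom_stabilizer G N H f"
  obtain g where g: "g \<in> hom (G\<lparr>carrier := L\<rparr>) F" "\<And>n. n \<in> N \<Longrightarrow> g n = f n"
    using hom_extends_to_mult_hom_stabilizer[OF assms(1) f] unfolding L_def by blast
  interpret K: subgroup "hom_stabilizer G N H f" G
    using NG HG by (rule subgroup_hom_stabilizer)
  have NL: "N \<subseteq> L"
    unfolding L_def using subset_set_mult(1)[OF N.subset K.subset] by simp
  \<comment> \<open>Surjectivity is inherited: \<open>g\<close> already attains all of
    \<open>carrier F\<close> on \<open>N\<close>, where it agrees with \<open>f\<close>.\<close>
  have "g ` L \<subseteq> carrier F" using hom_in_carrier[OF g(1)] by auto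
  moreover have "g ` N = carrier F" using g(2) sur by simp
  ultimately have "g ` L = carrier F" using NL by blast
  then have "surjects_to (G\<lparr>carrier := L\<rparr>) F"
    using g(1) by (auto simp: surjects_to_def epi_def)
  moreover have "finite_index_subgroup L G"
    unfolding L_def using finite_index_mult_hom_stabilizer assms f by blast
  ultimately show ?thesis using NL by blast
qed

end
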